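(* Let $\mu,\nu$ be probability measures on $\mathbb{R}^d$ with compact supports $X,Y\subset\mathbb{R}^d$ respectively, and let $c:X\times Y\to\mathbb{R}$ be continuous. For grid spacings $h>0$ let $\pi^h$ be (the embedding as a measure of) an optimal solution of the discrete linear program (LP) at grid resolution $h$ described in the context. Then, up to extraction of a subsequence, $\pi^h$ converges weakly, as $h\to0$, to an optimal transference plan between $\mu$ and $\nu$. That is, for every sequence $h_k\to 0$ and every choice of optimal solutions $\pi^{h_k}$ of (LP) at resolution $h_k$, there are a subsequence of $(\pi^{h_k})$ and a minimizer $\pi$ of $$I[\pi]=\int_{X\times Y}c(x,y)\,d\pi(x,y)\quad\text{over }\pi\in\Pi(\mu,\nu)$$ such that the subsequence converges weakly to $\pi$.
   Context: $\Pi(\mu,\nu)$ is the set of transference plans: probability measures $\pi$ on $X\times Y$ with $\pi[A\times Y]=\mu(A)$ and $\pi[X\times B]=\nu(B)$ for all measurable $A\subset X$, $B\subset Y$. An optimal transference plan is a minimizer of $I$ over $\Pi(\mu,\nu)$. Discretization at resolution $h>0$. Let $X^h=h\mathbb{Z}^d\cap X=\{x_1,\dots,x_n\}$ and $Y^h=h\mathbb{Z}^d\cap Y=\{y_1,\dots,y_m\}$. For a grid point $z$ let $R_h(z)=z+[-h/2,h/2)^d$ be the cube of width $h$ centred at $z$. Define $$\mu^h=\sum_{i=1}^n\mu_i^h\delta_{x_i},\quad \mu_i^h=\mu(R_h(x_i)),\qquad \nu^h=\sum_{j=1}^m\nu_j^h\delta_{y_j},\quad \nu_j^h=\nu(R_h(y_j)),$$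 and $c_{ij}=c(x_i,y_j)$. The discrete measures in (LP) are probability measures, i.e. the resolutions $h$ considered are such that $\sum_i\mu_i^h=\sum_j\nu_j^h=1$. (LP) at resolution $h$: minimize $\sum_{i=1}^n\sum_{j=1}^m c_{ij}\pi_{ij}$ over real $n\times m$ matrices $(\pi_{ij})$ satisfying $\pi_{ij}\ge0$, $\sum_{j=1}^m\pi_{ij}=\mu_i^h$ for all $i$, and $\sum_{i=1}^n\pi_{ij}=\nu_j^h$ for all $j$. An optimal solution $(\pi^h_{ij})$ is identified with the measure $\pi^h=\sum_{i=1}^n\sum_{j=1}^m\pi_{ij}^h\,\delta_{(x_i,y_j)}$ on $X\times Y$. Weak convergence means convergence of integrals against all continuous bounded functions. *)

theory Defs
  imports "HOL-Probability.Probability"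
begin

definition measure_support :: "'a::topological_space measure \<Rightarrow> 'a set" where
  "measure_support M = {x. \<forall>U. open U \<and> x \<in> U \<longrightarrow> 0 < emeasure M U}"

text \<open>
  A measure on a subset \<open>S\<close> of a Euclidean space is a measure whose underlying measurable
  space is \<^term>\<open>restrict_space borel S\<close>, i.e. its space is \<open>S\<close> with the Borel sets of the
  subspace topology.
\<close>

definition transference_plans ::
  "(real^'d) set \<Rightarrow> (real^'d) set \<Rightarrow> (real^'d) measure \<Rightarrow> (real^'d) measure
    \<Rightarrow> ((real^'d) \<times> (real^'d)) measure set" where
  "transference_plans X Y \<mu> \<nu> =
    {\<pi>. prob_space \<pi> \<and> sets \<pi> = sets (restrict_space borel (X \<times> Y)) \<and>
        (\<forall>A\<in>sets borel. A \<subseteq> X \<longrightarrow> measure \<pi> (A \<times> Y) = measure \<mu> A) \<and>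
        (\<forall>B\<in>sets borel. B \<subseteq> Y \<longrightarrow> measure \<pi> (X \<times> B) = measure \<nu> B)}"

definition transport_cost ::
  "((real^'d) \<times> (real^'d) \<Rightarrow> real) \<Rightarrow> ((real^'d) \<times> (real^'d)) measure \<Rightarrow> real" where
  "transport_cost c \<pi> = (\<integral>z. c z \<partial>\<pi>)"

definition optimal_plan ::
  "(real^'d) set \<Rightarrow> (real^'d) set \<Rightarrow> (real^'d) measure \<Rightarrow> (real^'d) measure
    \<Rightarrow> ((real^'d) \<times> (real^'d) \<Rightarrow> real) \<Rightarrow> ((real^'d) \<times> (real^'d)) measure \<Rightarrow> bool" where
  "optimal_plan X Y \<mu> \<nu> c \<pi> \<longleftrightarrow>
    is_arg_min (transport_cost c) (\<lambda>\<pi>. \<pi> \<in> transference_plans X Y \<mu> \<nu>) \<pi>"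

definition grid_points :: "real \<Rightarrow> (real^'d) set \<Rightarrow> (real^'d) set" where
  "grid_points h S = {x \<in> S. \<forall>i. \<exists>k::int. x $ i = h * of_int k}"

definition grid_cube :: "real \<Rightarrow> real^'d \<Rightarrow> (real^'d) set" where
  "grid_cube h z = {x. \<forall>i. z $ i - h / 2 \<le> x $ i \<and> x $ i < z $ i + h / 2}"

definition grid_mass :: "(real^'d) measure \<Rightarrow> real \<Rightarrow> real^'d \<Rightarrow> real" where
  "grid_mass \<mu> h z = measure \<mu> (grid_cube h z)"

text \<open>
  A matrix \<open>(\<pi>\<^sub>i\<^sub>j)\<close> is indexed by the grid points \<open>x\<^sub>i\<close>, \<open>y\<^sub>j\<close> themselves, so it is a function
  \<open>p\<close> with \<open>p x\<^sub>i y\<^sub>j = \<pi>\<^sub>i\<^sub>j\<close>. Its values off the grids are irrelevant: none of the notions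
  below looks at them.
\<close>

definition lp_feasible ::
  "(real^'d) set \<Rightarrow> (real^'d) set \<Rightarrow> (real^'d) measure \<Rightarrow> (real^'d) measure \<Rightarrow> real
    \<Rightarrow> (real^'d \<Rightarrow> real^'d \<Rightarrow> real) \<Rightarrow> bool" where
  "lp_feasible X Y \<mu> \<nu> h p \<longleftrightarrow>
    (\<forall>x\<in>grid_points h X. \<forall>y\<in>grid_points h Y. 0 \<le> p x y) \<and>
    (\<forall>x\<in>grid_points h X. (\<Sum>y\<in>grid_points h Y. p x y) = grid_mass \<mu> h x) \<and>
    (\<forall>y\<in>grid_points h Y. (\<Sum>x\<in>grid_points h X. p x y) = grid_mass \<nu> h y)"

definition lp_cost ::
  "(real^'d) set \<Rightarrow> (real^'d) set \<Rightarrow> ((real^'d) \<times> (real^'d) \<Rightarrow> real) \<Rightarrow> real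
    \<Rightarrow> (real^'d \<Rightarrow> real^'d \<Rightarrow> real) \<Rightarrow> real" where
  "lp_cost X Y c h p = (\<Sum>x\<in>grid_points h X. \<Sum>y\<in>grid_points h Y. c (x, y) * p x y)"

definition lp_optimal ::
  "(real^'d) set \<Rightarrow> (real^'d) set \<Rightarrow> (real^'d) measure \<Rightarrow> (real^'d) measure
    \<Rightarrow> ((real^'d) \<times> (real^'d) \<Rightarrow> real) \<Rightarrow> real \<Rightarrow> (real^'d \<Rightarrow> real^'d \<Rightarrow> real) \<Rightarrow> bool" where
  "lp_optimal X Y \<mu> \<nu> c h p \<longleftrightarrow> is_arg_min (lp_cost X Y c h) (lp_feasible X Y \<mu> \<nu> h) p"

text \<open>
  The measure \<open>\<Sum>\<^sub>i \<Sum>\<^sub>j \<pi>\<^sub>i\<^sub>j \<delta>\<close>, with Dirac masses at \<open>(x\<^sub>i, y\<^sub>j)\<close>, as a Borel measure on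
  \<open>X \<times> Y\<close>: the finite point measure on the product grid, pushed forward along the inclusion
  into \<open>X \<times> Y\<close>; see \<open>emeasure_lp_measure\<close> below.
\<close>

definition lp_measure ::
  "(real^'d) set \<Rightarrow> (real^'d) set \<Rightarrow> real \<Rightarrow> (real^'d \<Rightarrow> real^'d \<Rightarrow> real)
    \<Rightarrow> ((real^'d) \<times> (real^'d)) measure" where
  "lp_measure X Y h p =
    distr (point_measure (grid_points h X \<times> grid_points h Y) (\<lambda>(x, y). ennreal (p x y)))
      (restrict_space borel (X \<times> Y)) (\<lambda>z. z)"

lemma emeasure_lp_measure:
  assumes fin: "finite (grid_points h X)" "finite (grid_points h Y)"
    and A: "A \<in> sets (restrict_space borel (X \<times> Y))"
  shows "emeasure (lp_measure X Y h p) A =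
    (\<Sum>x\<in>grid_points h X. \<Sum>y\<in>grid_points h Y. ennreal (p x y) * indicator A (x, y))"
proof -
  let ?G = "grid_points h X \<times> grid_points h Y"
  let ?P = "point_measure ?G (\<lambda>(x, y). ennreal (p x y))"
  have G: "?G \<subseteq> X \<times> Y" by (auto simp: grid_points_def)
  have meas: "(\<lambda>z. z) \<in> measurable ?P (restrict_space borel (X \<times> Y))"
    using G by (auto simp: space_restrict_space)
  have "emeasure (lp_measure X Y h p) A = emeasure ?P (A \<inter> ?G)"
    unfolding lp_measure_def using meas A
    by (simp add: emeasure_distr space_point_measure)
  also have "\<dots> = (\<Sum>(x, y)\<in>A \<inter> ?G. ennreal (p x y))"
    using fin by (intro emeasure_point_measure_finite) auto
  also have "\<dots> = (\<Sum>(x, y)\<in>?G. ennreal (p x y) * indicator A (x, y))"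
    using fin by (intro sum.mono_neutral_cong_left) (auto simp: indicator_def)
  finally show ?thesis by (simp add: sum.cartesian_product)
qed

definition weakly_converges_on ::
  "'a::topological_space set \<Rightarrow> (nat \<Rightarrow> 'a measure) \<Rightarrow> 'a measure \<Rightarrow> bool" where
  "weakly_converges_on S P Q \<longleftrightarrow>
    (\<forall>f::'a \<Rightarrow> real. continuous_on S f \<and> bounded (f ` S) \<longrightarrow>
      (\<lambda>k. \<integral>z. f z \<partial>P k) \<longlonglongrightarrow> (\<integral>z. f z \<partial>Q))"

end

theory Submission
  imports Defs
begin

text \<open>
  Weak compactness of probability measures on a compact set \<open>Z\<close> reduces to Helly's selection
  theorem on the real line: \<open>Z\<close> embeds into the reals by a bounded measurable injection whose
  inverse extends continuously to the closure of the image, so measures are pushed to the line,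
  a subsequence is selected there, and its limit is pulled back.

  Rounding both coordinates to the nearest grid point, \<open>T\<^sub>h\<close>, turns every transference plan \<open>\<sigma>\<close>
  into a matrix feasible for (LP). Its discrete cost is the integral of \<open>c \<circ> T\<^sub>h\<close> against \<open>\<sigma>\<close>, which
  tends to the cost of \<open>\<sigma>\<close> because \<open>T\<^sub>h\<close> tends to the identity. Passing to the limit in the
  inequality between the two discrete costs gives optimality of the limit. For costs depending on
  one coordinate only, all feasible matrices have the same discrete cost, so comparison with
  the product plan identifies the marginals of the limit.
\<close>

section \<open>Weak compactness on compact sets\<close>

text \<open>The first nonzero term has modulus \<open>(1/3) ^ i\<close>, and all later terms
  together contribute at most half of that. Base 3 leaves this gap; in base 2 the tail could cancel
  the leading term.\<close>

lemma ternary_gap: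
  fixes d :: "nat \<Rightarrow> real"
  assumes d: "\<And>k. \<bar>d k\<bar> \<le> 1" and zero: "\<And>k. k < i \<Longrightarrow> d k = 0" and one: "\<bar>d i\<bar> = 1"
  shows "(1/3) ^ i / 2 \<le> \<bar>\<Sum>k. (1/3) ^ k * d k\<bar>"
proof -
  let ?f = "\<lambda>k. (1/3) ^ k * d k"
  have geom: "summable (\<lambda>k. (1/3 :: real) ^ (k + m))" for m
    by (simp add: power_add summable_mult2 summable_geometric)
  have bound: "norm (?f k) \<le> (1/3) ^ k" for k
    using d[of k] by (simp add: abs_mult mult_left_le)
  have summable: "summable ?f"
    by (rule summable_comparison_test'[of "\<lambda>k. (1/3) ^ k" 0]) (use geom[of 0] bound in auto)
  have "\<bar>\<Sum>k. ?f (k + Suc i)\<bar> \<le> (\<Sum>k. (1/3) ^ (k + Suc i))"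
    using bound[of "_ + Suc i"] geom[of "Suc i"] norm_suminf_le[of "\<lambda>k. ?f (k + Suc i)"] by auto
  also have "\<dots> = (\<Sum>k. (1/3) ^ k) * (1/3) ^ Suc i"
    by (subst suminf_mult2) (simp_all add: summable_geometric power_add)
  also have "\<dots> = (1/3) ^ i / 2"
    by (simp add: suminf_geometric)
  finally have tail: "\<bar>\<Sum>k. ?f (k + Suc i)\<bar> \<le> (1/3) ^ i / 2" .
  have "(\<Sum>k. ?f k) = (\<Sum>k. ?f (k + Suc i)) + ?f i"
    using suminf_split_initial_segment[OF summable, of "Suc i"] zero by simp
  moreover have "\<bar>?f i\<bar> = (1/3) ^ i"
    using one by (simp add: abs_mult)
  ultimately show ?thesis
    using tail by linarith
qed

text \<open>
  The ternary expansion \<open>s z\<close> has digits telling which sets of a countable basis contain \<open>z\<close>.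
  By compactness finitely many digits determine \<open>z\<close> up to a given error, so the inverse of \<open>s\<close>
  is uniformly continuous and extends to the closure. The map \<open>s\<close> itself is only measurable.
\<close>

lemma compact_real_encoding:
  fixes Z :: "'a::polish_space set"
  assumes "compact Z"
  obtains s :: "'a \<Rightarrow> real" and g :: "real \<Rightarrow> 'a"
  where "s \<in> borel_measurable borel" and "\<And>z. \<bar>s z\<bar> \<le> 3/2"
    and "continuous_on (closure (s ` Z)) g" and "g ` closure (s ` Z) \<subseteq> Z"
    and "\<And>z. z \<in> Z \<Longrightarrow> g (s z) = z"
proof -
  obtain B :: "'a set set" where B: "countable B" "topological_basis B"
    using ex_countable_basis by blast
  define A where "A = from_nat_into B"
  \<comment> \<open>\<open>from_nat_into\<close> enumerates nonempty countable sets;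
    \<open>B\<close> is nonempty because some basis set contains any given point.\<close>
  have range_A: "range A = B"
    unfolding A_def
    using topological_basisE[OF B(2) open_UNIV UNIV_I] B(1) by (intro range_from_nat_into) blast+
  then have open_A [measurable]: "open (A k)" for k
    using B topological_basis_open by blast
  define a where "a k z = (indicator (A k) z :: real)" for k z
  define s where "s z = (\<Sum>k. (1/3) ^ k * a k z)" for z
  have a01: "a k z \<in> {0, 1}" for k z
    by (simp add: a_def indicator_def)
  have geom: "(\<lambda>k. (1/3) ^ k) sums (3/2 :: real)"
    using geometric_sums[of "1/3 :: real"] by simp
  have bound: "norm ((1/3) ^ k * a k z) \<le> (1/3) ^ k" for k z
    using a01[of k z] by auto
  have summable: "summable (\<lambda>k. (1/3) ^ k * a k z)" for z
    by (rule summable_comparison_test'[OF sums_summable[OF geom], of 0]) (rule bound)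
  have s_meas: "s \<in> borel_measurable borel"
    unfolding s_def a_def using open_A
    by (intro borel_measurable_suminf borel_measurable_times borel_measurable_indicator) auto
  have s_bound: "\<bar>s z\<bar> \<le> 3/2" for z
    using norm_suminf_le[OF bound[of _ z] sums_summable[OF geom]] sums_unique[OF geom]
    by (simp add: s_def)
  \<comment> \<open>Take the first digit \<open>i\<close> at which \<open>z\<close> and
    \<open>w\<close> differ. By \<open>ternary_gap\<close> the values \<open>s z\<close> and
    \<open>s w\<close> are at least \<open>(1/3) ^ i / 2\<close> apart, so closeness forces
    \<open>n < i\<close>, against \<open>i <= k < n\<close>.\<close>
  have agree: "a k z = a k w" if "k < n" "\<bar>s z - s w\<bar> < (1/3) ^ n / 2" for k n z w
  proof (rule ccontr)
    assume "a k z \<noteq> a k w"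
    define i where "i = (LEAST i. a i z \<noteq> a i w)"
    have i: "a i z \<noteq> a i w"
      unfolding i_def by (rule LeastI) fact
    have "i \<le> k"
      unfolding i_def by (rule Least_le) fact
    have "(1/3) ^ i / 2 \<le> \<bar>\<Sum>j. (1/3) ^ j * (a j z - a j w)\<bar>"
    proof (rule ternary_gap)
      show "\<bar>a j z - a j w\<bar> \<le> 1" for j
        using a01[of j z] a01[of j w] by auto
      show "a j z - a j w = 0" if "j < i" for j
        using not_less_Least[OF that[unfolded i_def]] by simp
      show "\<bar>a i z - a i w\<bar> = 1"
        using a01[of i z] a01[of i w] i by auto
    qed
    also have "(\<Sum>j. (1/3) ^ j * (a j z - a j w)) = s z - s w"
      using suminf_diff[OF summable[of z] summable[of w]] by (simp add: s_def right_diff_distrib)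
    finally have "(1/3) ^ i < (1/3 :: real) ^ n"
      using that(2) by linarith
    then have "n < i"
      by simp
    with \<open>i \<le> k\<close> \<open>k < n\<close> show False by simp
  qed
  \<comment> \<open>Basis sets lying in balls of radius \<open>e/2\<close> cover \<open>Z\<close>;
    finitely many suffice, and \<open>n\<close> exceeds all their indices. Equality of the first
    \<open>n\<close> digits then puts \<open>z\<close> and \<open>w\<close> into a common one of
    these small sets.\<close>
  have separate: "\<exists>\<delta>>0. \<forall>z\<in>Z. \<forall>w\<in>Z. \<bar>s z - s w\<bar> < \<delta> \<longrightarrow> dist z w < e" if "0 < e" for e
  proof -
    define I where "I = {k. \<exists>z. A k \<subseteq> ball z (e/2)}"
    have "Z \<subseteq> (\<Union>k\<in>I. A k)"
    proof
      fix z assume "z \<in> Z"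
      have "open (ball z (e/2))" "z \<in> ball z (e/2)" using \<open>0 < e\<close> by auto
      then obtain b where "b \<in> B" "z \<in> b" "b \<subseteq> ball z (e/2)"
        using topological_basisE[OF B(2)] by metis
      moreover from \<open>b \<in> B\<close> obtain k where "A k = b"
        using range_A by blast
      ultimately show "z \<in> (\<Union>k\<in>I. A k)"
        unfolding I_def by blast
    qed
    then obtain F where F: "F \<subseteq> I" "finite F" "Z \<subseteq> (\<Union>k\<in>F. A k)"
      using compactE_image[OF assms, of I A] open_A by metis
    obtain n where n: "\<And>k. k \<in> F \<Longrightarrow> k < n"
      using finite_nat_set_iff_bounded[THEN iffD1, OF F(2)] by blast
    show ?thesis
    proof (intro exI[of _ "(1/3) ^ n / 2"] conjI ballI impI)
      fix z w assume "z \<in> Z" "w \<in> Z" and close: "\<bar>s z - s w\<bar> < (1/3) ^ n / 2"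
      then obtain k where k: "k \<in> F" "z \<in> A k" using F by auto
      have "a k z = a k w" using agree[OF n[OF k(1)] close] .
      then have "w \<in> A k" using k(2) by (simp add: a_def indicator_def split: if_splits)
      have "k \<in> I" using k(1) F(1) by blast
      then obtain u where "A k \<subseteq> ball u (e/2)" unfolding I_def by blast
      then have "dist u z < e/2" "dist u w < e/2"
        using k(2) \<open>w \<in> A k\<close> unfolding subset_iff mem_ball by blast+
      then show "dist z w < e" by (rule dist_triangle_half_r)
    qed simp
  qed
  have inj: "inj_on s Z"
  proof (rule inj_onI, rule ccontr)
    fix z w assume zw: "z \<in> Z" "w \<in> Z" "s z = s w" "z \<noteq> w"
    then show False using separate[of "dist z w"] by fastforce
  qed
  define t where "t = inv_into Z s"
  have t: "t (s z) = z" if "z \<in> Z" for z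
    using inj that by (simp add: t_def)
  have "uniformly_continuous_on (s ` Z) t"
    unfolding uniformly_continuous_on_def
  proof (intro allI impI)
    fix e :: real assume "0 < e"
    from separate[OF this] obtain \<delta>
      where "\<delta> > 0" "\<forall>z\<in>Z. \<forall>w\<in>Z. \<bar>s z - s w\<bar> < \<delta> \<longrightarrow> dist z w < e" by blast
    then show "\<exists>d>0. \<forall>x\<in>s ` Z. \<forall>x'\<in>s ` Z. dist x' x < d \<longrightarrow> dist (t x') (t x) < e"
      by (intro exI[of _ \<delta>]) (auto simp: t dist_real_def)
  qed
  then obtain g where g: "uniformly_continuous_on (closure (s ` Z)) g" "\<And>x. x \<in> s ` Z \<Longrightarrow> t x = g x"
    using uniformly_continuous_on_extension_on_closure by metis
  have cont: "continuous_on (closure (s ` Z)) g"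
    using g(1) uniformly_continuous_imp_continuous by blast
  have gs: "g (s z) = z" if "z \<in> Z" for z
    using g(2)[of "s z"] t that by simp
  have "g ` closure (s ` Z) \<subseteq> Z"
    using cont gs compact_imp_closed[OF assms] by (intro image_closure_subset) auto
  with s_meas s_bound cont gs that show thesis by blast
qed

text \<open>The limit \<open>M\<close> selected on the line can be pulled back because it is carried
  by the closed set \<open>K\<close>, where \<open>g\<close> is continuous. Weak convergence returns
  to \<open>Z\<close> through \<open>f\<close> composed with \<open>g\<close>, so measurability of
  \<open>s\<close> is enough.\<close>

lemma compact_weak_subsequence:
  fixes Z :: "'a::polish_space set"
  assumes Z: "compact Z" and prob: "\<And>k. prob_space (P k)"
    and sets_P: "\<And>k. sets (P k) = sets (restrict_space borel Z)"
  obtains r :: "nat \<Rightarrow> nat" and Q where "strict_mono r" and "prob_space Q"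
    and "sets Q = sets (restrict_space borel Z)" and "weakly_converges_on Z (\<lambda>k. P (r k)) Q"
proof -
  obtain s :: "'a \<Rightarrow> real" and g where s [measurable]: "s \<in> borel_measurable borel"
    and s_bound: "\<And>z. \<bar>s z\<bar> \<le> 3/2" and g_cont: "continuous_on (closure (s ` Z)) g"
    and g_into: "g ` closure (s ` Z) \<subseteq> Z" and gs: "\<And>z. z \<in> Z \<Longrightarrow> g (s z) = z"
    using compact_real_encoding[OF Z] by metis
  define K where "K = closure (s ` Z)"
  have K: "closed K" "\<And>z. z \<in> Z \<Longrightarrow> s z \<in> K"
    unfolding K_def using closure_subset[of "s ` Z"] by auto
  have space_P: "space (P k) = Z" for k
    using sets_eq_imp_space_eq[OF sets_P[of k]] by (simp add: space_restrict_space)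
  obtain z0 where z0: "z0 \<in> Z"
    using prob_space.not_empty[OF prob[of 0]] space_P[of 0] by auto
  have s_P [measurable]: "s \<in> borel_measurable (P k)" for k
    unfolding measurable_cong_sets[OF sets_P refl] using s by (rule measurable_restrict_space1)
  define N where "N k = distr (P k) borel s" for k
  have N: "real_distribution (N k)" for k
    unfolding N_def using prob_space.real_distribution_distr[OF prob] s_P by blast
  have int_N: "(\<integral>x. f x \<partial>N k) = (\<integral>z. f (s z) \<partial>P k)" if "f \<in> borel_measurable borel"
    for f :: "real \<Rightarrow> real" and k
    unfolding N_def using that s_P by (intro integral_distr) auto
  \<comment> \<open>The bound \<open>3/2\<close> on \<open>s\<close> places all mass of every
    \<open>N k\<close> in one fixed half-open interval.\<close>
  have "tight N"
    unfolding tight_def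
  proof (intro conjI allI impI)
    fix \<epsilon> :: real assume "0 < \<epsilon>"
    have "measure (N k) {-2<..2} = 1" for k
    proof -
      have "s -` {-2<..2} \<inter> space (P k) = space (P k)"
      proof -
        have "-2 < s z \<and> s z \<le> 2" for z using s_bound[of z] by linarith
        then show ?thesis by auto
      qed
      then show ?thesis
        unfolding N_def using prob_space.prob_space[OF prob] by (subst measure_distr) auto
    qed
    then show "\<exists>a b. a < b \<and> (\<forall>k. 1 - \<epsilon> < measure (N k) {a<..b})"
      using \<open>0 < \<epsilon>\<close> by (intro exI[of _ "-2"] exI[of _ 2]) auto
  qed (fact N)
  then obtain r M where r: "strict_mono r" and M: "real_distribution M"
    and conv: "weak_conv_m (N \<circ> id \<circ> r) M"
    using tight_imp_convergent_subsubsequence[of N id] by (auto simp: strict_mono_def)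
  interpret M: real_distribution M by fact
  have lim: "(\<lambda>k. \<integral>z. f (s z) \<partial>P (r k)) \<longlonglongrightarrow> (\<integral>x. f x \<partial>M)"
    if f: "continuous_on UNIV f" and b: "\<And>x. norm (f x) \<le> b" for f :: "real \<Rightarrow> real" and b
  proof -
    have "(\<lambda>k. \<integral>x. f x \<partial>(N \<circ> id \<circ> r) k) \<longlonglongrightarrow> (\<integral>x. f x \<partial>M)"
      using f b N by (intro weak_conv_imp_integral_bdd_continuous_conv[OF _ M conv])
        (auto simp: continuous_on_eq_continuous_at)
    then show ?thesis
      using int_N[OF borel_measurable_continuous_onI[OF f]] by simp
  qed
  \<comment> \<open>The test function is continuous, bounded and zero on the image of
    \<open>Z\<close> under \<open>s\<close>, so its integral is zero along the sequence and hence in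
    the limit. The point \<open>z0\<close> makes \<open>K\<close> nonempty; the distance to the
    empty set is zero by convention.\<close>
  have AE_K: "AE x in M. x \<in> K"
  proof -
    let ?f = "\<lambda>x. min 1 (infdist x K)"
    have f: "continuous_on UNIV ?f" by (intro continuous_intros)
    have fs: "?f (s z) = 0" if "z \<in> Z" for z
      using K(2)[OF that] by simp
    have "(\<lambda>k. \<integral>z. ?f (s z) \<partial>P (r k)) \<longlonglongrightarrow> (\<integral>x. ?f x \<partial>M)"
      by (rule lim[OF f, of 1]) (simp add: infdist_nonneg)
    moreover have "(\<integral>z. ?f (s z) \<partial>P (r k)) = 0" for k
      using fs by (subst Bochner_Integration.integral_cong[where g="\<lambda>_. 0"]) (auto simp: space_P)
    ultimately have "(\<integral>x. ?f x \<partial>M) = 0"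
      by (simp add: LIMSEQ_const_iff)
    moreover have "integrable M ?f"
      using borel_measurable_continuous_onI[OF f]
      by (intro M.integrable_const_bound[of _ 1]) (auto simp: infdist_nonneg)
    ultimately have "AE x in M. ?f x = 0"
      by (subst (asm) integral_nonneg_eq_0_iff_AE) (auto simp: infdist_nonneg)
    moreover have "x \<in> K" if "?f x = 0" for x
    proof -
      have "infdist x K = 0" using that by linarith
      then show ?thesis using K(1) K(2)[OF z0] in_closed_iff_infdist_zero by blast
    qed
    ultimately show ?thesis by (rule eventually_mono)
  qed
  \<comment> \<open>The default \<open>z0\<close> makes the map total with values in
    \<open>Z\<close>; by \<open>AE_K\<close> it is taken only on a null set.\<close>
  define g' where "g' x = (if x \<in> K then g x else z0)" for x
  have g' [measurable]: "g' \<in> measurable M (restrict_space borel Z)"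
  proof (rule measurable_restrict_space2)
    show "g' \<in> space M \<rightarrow> Z" using g_into z0 by (auto simp: g'_def K_def image_subset_iff)
    have "g' \<in> borel_measurable borel"
      unfolding g'_def using K(1) g_cont
      by (intro borel_measurable_continuous_on_if) (auto simp: K_def)
    then show "g' \<in> borel_measurable M" by simp
  qed
  define Q where "Q = distr M (restrict_space borel Z) g'"
  have "weakly_converges_on Z (\<lambda>k. P (r k)) Q"
    unfolding weakly_converges_on_def
  proof (intro allI impI, elim conjE)
    fix f :: "'a \<Rightarrow> real" assume f: "continuous_on Z f" and "bounded (f ` Z)"
    then obtain b where b: "\<And>z. z \<in> Z \<Longrightarrow> norm (f z) \<le> b" by (auto simp: bounded_iff)
    \<comment> \<open>The composition is continuous on \<open>K\<close> only, whereas
      \<open>lim\<close> wants a function on the whole line. Tietze's theorem extends it and keeps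
      the bound \<open>b\<close>.\<close>
    have "continuous_on K (f \<circ> g)"
      using g_cont continuous_on_subset[OF f g_into] unfolding K_def by (rule continuous_on_compose)
    moreover have "0 \<le> b" using b[OF z0] norm_ge_zero order_trans by blast
    moreover have "norm ((f \<circ> g) x) \<le> b" if "x \<in> K" for x
      using b g_into that by (auto simp: K_def image_subset_iff)
    moreover have "closedin (top_of_set UNIV) K" using K(1) by simp
    ultimately obtain F where "continuous_on UNIV F" "\<And>x. x \<in> K \<Longrightarrow> F x = (f \<circ> g) x"
      "\<And>x. x \<in> UNIV \<Longrightarrow> norm (F x) \<le> b"
      using Tietze[of K "f \<circ> g" UNIV b] by metis
    then have F: "continuous_on UNIV F" "\<And>x. x \<in> K \<Longrightarrow> F x = f (g x)" "\<And>x. norm (F x) \<le> b"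
      by simp_all
    have [measurable]: "F \<in> borel_measurable borel"
      using F(1) by (rule borel_measurable_continuous_onI)
    have [measurable]: "f \<in> borel_measurable (restrict_space borel Z)"
      using f by (rule borel_measurable_continuous_on_restrict)
    have "(\<integral>z. F (s z) \<partial>P (r k)) = (\<integral>z. f z \<partial>P (r k))" for k
      using F(2) K(2) gs by (intro Bochner_Integration.integral_cong) (auto simp: space_P)
    moreover have "(\<integral>x. F x \<partial>M) = (\<integral>z. f z \<partial>Q)"
    proof -
      have "(\<integral>x. F x \<partial>M) = (\<integral>x. f (g' x) \<partial>M)"
      proof (rule integral_cong_AE)
        show "AE x in M. F x = f (g' x)"
          using AE_K by eventually_elim (simp add: F(2) g'_def)
      qed measurable
      then show ?thesis
        unfolding Q_def by (simp add: integral_distr)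
    qed
    ultimately show "(\<lambda>k. \<integral>z. f z \<partial>P (r k)) \<longlonglongrightarrow> (\<integral>z. f z \<partial>Q)"
      using lim[OF F(1,3)] by simp
  qed
  moreover have "prob_space Q" "sets Q = sets (restrict_space borel Z)"
    unfolding Q_def using g' by (auto intro: M.prob_space_distr)
  ultimately show thesis using r that by blast
qed

section \<open>Borel measures and discretisation\<close>

text \<open>Closed sets form an intersection-stable generator of the Borel sets, and the indicator
  of a closed set is a bounded pointwise limit of continuous functions.\<close>

lemma borel_prob_eqI:
  fixes M N :: "'a::metric_space measure"
  assumes "prob_space M" "prob_space N" and sets: "sets M = sets borel" "sets N = sets borel"
    and eq: "\<And>f :: 'a \<Rightarrow> real. continuous_on UNIV f \<Longrightarrow> bounded (range f) \<Longrightarrow> (\<integral>x. f x \<partial>M) = (\<integral>x. f x \<partial>N)"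
  shows "M = N"
proof (rule measure_eqI_generator_eq[where E="Collect closed" and \<Omega>=UNIV and A="\<lambda>_. UNIV"])
  interpret M: prob_space M by fact
  interpret N: prob_space N by fact
  show "sets M = sigma_sets UNIV (Collect closed)" "sets N = sigma_sets UNIV (Collect closed)"
    unfolding sets by (simp_all add: borel_eq_closed)
  show "Int_stable (Collect closed)" by (auto simp: Int_stable_def)
  fix C :: "'a set" assume "C \<in> Collect closed"
  then have C: "closed C" by simp
  show "emeasure M C = emeasure N C"
  proof (cases "C = {}")
    case False
    \<comment> \<open>These functions decrease to the indicator of \<open>C\<close>. The empty set
      is treated apart because \<open>infdist x {}\<close> is zero, which would make every
      \<open>f n\<close> constantly one.\<close>
    define f where "f n x = max 0 (1 - real n * infdist x C)" for n x
    have f: "continuous_on UNIV (f n)" for n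
      unfolding f_def by (intro continuous_intros)
    have f_meas: "f n \<in> borel_measurable borel" for n
      using f by (rule borel_measurable_continuous_onI)
    have f01: "0 \<le> f n x" "f n x \<le> 1" for n x
      by (auto simp: f_def infdist_nonneg)
    have f_lim: "(\<lambda>n. f n x) \<longlonglongrightarrow> indicator C x" for x
    proof (cases "x \<in> C")
      case True
      then show ?thesis by (simp add: f_def)
    next
      case x: False
      then have d: "0 < infdist x C"
        using C False by (metis in_closed_iff_infdist_zero infdist_nonneg less_le)
      obtain m where m: "1 / infdist x C < real m" using reals_Archimedean2 by blast
      have "f n x = 0" if "m \<le> n" for n
      proof -
        have "1 / infdist x C < real n" using m that by simp
        then have "1 < real n * infdist x C" using d by (simp add: divide_less_eq)
        then show ?thesis by (simp add: f_def)
      qed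
      then show ?thesis using x by (intro tendsto_eventually) (auto simp: eventually_sequentially)
    qed
    have "(\<lambda>n. \<integral>x. f n x \<partial>L) \<longlonglongrightarrow> measure L C" if "prob_space L" "sets L = sets borel" for L
    proof -
      interpret L: prob_space L by fact
      note that(2) [measurable_cong]
      have [measurable]: "f n \<in> borel_measurable L" for n using f_meas that(2) by simp
      have [measurable]: "C \<in> sets L" using C that(2) by simp
      have "(\<lambda>n. \<integral>x. f n x \<partial>L) \<longlonglongrightarrow> (\<integral>x. indicator C x \<partial>L)"
        using f01 f_lim by (intro integral_dominated_convergence[where w="\<lambda>_. 1"]) auto
      then show ?thesis using sets_eq_imp_space_eq[OF that(2)] by simp
    qed
    from this[OF assms(1) sets(1)] this[OF assms(2) sets(2)]
    moreover have "(\<integral>x. f n x \<partial>M) = (\<integral>x. f n x \<partial>N)" for n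
      using f f01 by (intro eq) (auto simp: bounded_iff intro!: exI[of _ 1])
    ultimately have "measure M C = measure N C"
      using LIMSEQ_unique by simp
    then show ?thesis by (simp add: M.emeasure_eq_measure N.emeasure_eq_measure)
  qed simp
qed (use prob_space.finite_measure[OF assms(1)] finite_measure.emeasure_finite in \<open>auto\<close>)

text \<open>Every point outside the support lies in a null set of a countable basis, so the
  complement is covered by countably many null sets.\<close>

lemma AE_measure_support:
  fixes M :: "'a::second_countable_topology measure"
  assumes "sets M = sets borel"
  shows "AE x in M. x \<in> measure_support M"
proof -
  obtain B :: "'a set set" where B: "countable B" "topological_basis B"
    using ex_countable_basis by blast
  have "AE x in M. \<forall>b\<in>{b \<in> B. emeasure M b = 0}. x \<notin> b"
  proof (subst AE_ball_countable)
    show "countable {b \<in> B. emeasure M b = 0}" using B(1) by (rule countable_subset[rotated]) auto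
    show "\<forall>b\<in>{b \<in> B. emeasure M b = 0}. AE x in M. x \<notin> b"
      using topological_basis_open[OF B(2)] assms by (auto intro!: AE_not_in simp: null_sets_def)
  qed
  then show ?thesis
  proof (rule eventually_mono)
    fix x assume x: "\<forall>b\<in>{b \<in> B. emeasure M b = 0}. x \<notin> b"
    show "x \<in> measure_support M"
      unfolding measure_support_def
    proof (intro CollectI allI impI, elim conjE)
      fix U :: "'a set" assume U: "open U" "x \<in> U"
      then obtain b where b: "b \<in> B" "x \<in> b" "b \<subseteq> U"
        using topological_basisE[OF B(2)] by metis
      then have "emeasure M b \<noteq> 0" using x by auto
      moreover have "emeasure M b \<le> emeasure M U"
        using b U assms by (intro emeasure_mono) auto
      ultimately show "0 < emeasure M U" by (metis zero_less_iff_neq_zero le_zero_eq)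
    qed
  qed
qed

text \<open>The sum is the integral of \<open>f\<close> composed with \<open>T k\<close>, up to a
  null set, and these compositions converge to \<open>f\<close> by continuity. Compactness of
  \<open>Z\<close> supplies the constant bound for dominated convergence.\<close>

lemma discretised_integral_tendsto:
  fixes f :: "'a::metric_space \<Rightarrow> real" and T :: "nat \<Rightarrow> 'a \<Rightarrow> 'a"
  assumes "prob_space M" and Z: "compact Z" and f: "continuous_on Z f" and "f \<in> borel_measurable M"
    and ae_Z: "AE x in M. x \<in> Z" and G: "\<And>k. finite (G k)" "\<And>k. G k \<subseteq> Z"
    and cells: "\<And>k z. z \<in> G k \<Longrightarrow> T k -` {z} \<inter> space M \<in> sets M"
    and ae_G: "\<And>k. AE x in M. T k x \<in> G k" and T: "\<And>x. (\<lambda>k. T k x) \<longlonglongrightarrow> x"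
  shows "(\<lambda>k. \<Sum>z\<in>G k. f z * measure M (T k -` {z} \<inter> space M)) \<longlonglongrightarrow> (\<integral>x. f x \<partial>M)"
proof -
  interpret prob_space M by fact
  \<comment> \<open>This simple function stands in for \<open>f (T k x)\<close>: it is measurable as
    soon as the cells are, and it agrees with the composition wherever \<open>T k x\<close> lies in
    \<open>G k\<close>.\<close>
  define F where "F k x = (\<Sum>z\<in>G k. f z * indicator (T k -` {z} \<inter> space M) x)" for k x
  have F_meas: "F k \<in> borel_measurable M" for k
    unfolding F_def
    by (intro borel_measurable_sum borel_measurable_times borel_measurable_const
        borel_measurable_indicator cells)
  have F_eq: "F k x = f (T k x)" if "x \<in> space M" "T k x \<in> G k" for k x
  proof -
    have "F k x = (\<Sum>z\<in>G k. if z = T k x then f z else 0)"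
      unfolding F_def using that by (intro sum.cong) (auto simp: indicator_def)
    then show ?thesis using that G by (simp add: sum.delta)
  qed
  obtain b where b: "\<And>z. z \<in> Z \<Longrightarrow> norm (f z) \<le> b"
    using compact_imp_bounded[OF compact_continuous_image[OF f Z]] by (auto simp: bounded_iff)
  have ae: "AE x in M. \<forall>k. T k x \<in> G k"
    using ae_G by (simp add: AE_all_countable)
  have "(\<lambda>k. \<integral>x. F k x \<partial>M) \<longlonglongrightarrow> (\<integral>x. f x \<partial>M)"
  proof (rule integral_dominated_convergence[where w="\<lambda>_. b"])
    show "AE x in M. (\<lambda>k. F k x) \<longlonglongrightarrow> f x"
      using ae ae_Z AE_space
    proof eventually_elim
      case (elim x)
      have "(\<lambda>k. f (T k x)) \<longlonglongrightarrow> f x"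
        using elim G(2) by (intro continuous_on_tendsto_compose[OF f T]) (auto intro!: always_eventually)
      then show ?case using F_eq elim by simp
    qed
    show "AE x in M. norm (F k x) \<le> b" for k
      using ae AE_space
    proof eventually_elim
      case (elim x)
      then have "T k x \<in> Z" using G(2) by blast
      then show ?case using F_eq[of x k] elim b by simp
    qed
  qed (rule assms(4) F_meas integrable_const)+
  moreover have "(\<integral>x. F k x \<partial>M) = (\<Sum>z\<in>G k. f z * measure M (T k -` {z} \<inter> space M))" for k
  proof -
    have int: "integrable M (\<lambda>x. f z * indicator (T k -` {z} \<inter> space M) x)" if "z \<in> G k" for z
    proof (intro integrable_mult_right integrable_real_indicator cells that)
      show "emeasure M (T k -` {z} \<inter> space M) < \<infinity>"
        unfolding emeasure_eq_measure infinity_ennreal_def by (rule ennreal_less_top)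
    qed
    have "(\<integral>x. F k x \<partial>M) = (\<Sum>z\<in>G k. \<integral>x. f z * indicator (T k -` {z} \<inter> space M) x \<partial>M)"
      unfolding F_def by (rule Bochner_Integration.integral_sum[OF int])
    then show ?thesis
      by (simp only: integral_mult_right_zero Bochner_Integration.integral_indicator Int_assoc Int_absorb)
  qed
  ultimately show ?thesis by simp
qed

text \<open>Rounding every coordinate to a nearest multiple of \<open>h\<close> exhibits the cubes
  as fibres of a single measurable map, so disjointness and measurability of the cells come for
  free.\<close>

lemma grid_rounding:
  obtains T :: "real \<Rightarrow> real^'d \<Rightarrow> real^'d"
  where "\<And>h. T h \<in> borel_measurable borel"
    and "\<And>h z S. 0 < h \<Longrightarrow> z \<in> grid_points h S \<Longrightarrow> grid_cube h z = T h -` {z}"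
    and "\<And>h x. 0 < h \<Longrightarrow> dist (T h x) x \<le> real CARD('d) * h"
proof
  define T :: "real \<Rightarrow> real^'d \<Rightarrow> real^'d" where "T h x = (\<chi> i. h * of_int \<lfloor>x $ i / h + 1/2\<rfloor>)" for h x
  show "T h \<in> borel_measurable borel" for h
  proof -
    have "(\<lambda>x. T h x \<bullet> axis i 1) \<in> borel_measurable borel" for i
      unfolding T_def by (simp add: inner_axis) measurable
    then show ?thesis
      by (subst borel_measurable_euclidean_space) (auto simp: Basis_vec_def)
  qed
  show "grid_cube h z = T h -` {z}" if h: "0 < h" and z: "z \<in> grid_points h S" for h z S
  proof -
    \<comment> \<open>The half-open cube fits the floor function exactly: a tie at
      \<open>z $ i + h / 2\<close> is rounded up and belongs to the next cube.\<close>
    have "z $ i - h / 2 \<le> x $ i \<and> x $ i < z $ i + h / 2 \<longleftrightarrow> h * of_int \<lfloor>x $ i / h + 1/2\<rfloor> = z $ i" for x i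
    proof -
      obtain k :: int where k: "z $ i = h * of_int k"
        using z by (auto simp: grid_points_def)
      have "h * of_int \<lfloor>x $ i / h + 1/2\<rfloor> = z $ i \<longleftrightarrow> \<lfloor>x $ i / h + 1/2\<rfloor> = k"
        using h by (simp add: k)
      also have "\<dots> \<longleftrightarrow> of_int k \<le> x $ i / h + 1/2 \<and> x $ i / h + 1/2 < of_int k + 1"
        by (simp add: floor_eq_iff)
      also have "\<dots> \<longleftrightarrow> z $ i - h / 2 \<le> x $ i \<and> x $ i < z $ i + h / 2"
        using h by (auto simp: k field_simps)
      finally show ?thesis by simp
    qed
    then show ?thesis by (auto simp: grid_cube_def T_def vec_eq_iff)
  qed
  \<comment> \<open>A crude estimate by \<open>h\<close> in each coordinate, summed in the l1 norm;
    it only has to vanish with \<open>h\<close>.\<close>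
  show "dist (T h x) x \<le> real CARD('d) * h" if "0 < h" for h x
  proof -
    have "\<bar>(T h x - x) $ i\<bar> \<le> h" for i
    proof -
      have "(T h x - x) $ i = h * (of_int \<lfloor>x $ i / h + 1/2\<rfloor> - x $ i / h)"
        using that by (simp add: T_def right_diff_distrib)
      moreover have "\<bar>of_int \<lfloor>x $ i / h + 1/2\<rfloor> - x $ i / h\<bar> \<le> 1" by linarith
      ultimately show ?thesis using that by (simp add: abs_mult mult_left_le)
    qed
    then have "(\<Sum>i\<in>UNIV. \<bar>(T h x - x) $ i\<bar>) \<le> real CARD('d) * h"
      using sum_bounded_above[of UNIV "\<lambda>i. \<bar>(T h x - x) $ i\<bar>" h] by blast
    then show ?thesis
      using norm_le_l1_cart[of "T h x - x"] by (simp add: dist_norm)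
  qed
qed

section \<open>The linear program and transference plans\<close>

text \<open>Feasible matrices embed as probability measures on the compact set
  \<open>X \<times> Y\<close>, since the row sums are grid masses of total one. Integrals against
  them are discrete costs, so weak convergence becomes convergence of \<open>lp_cost\<close> for
  every continuous integrand.\<close>

lemma lp_weak_limit:
  fixes X Y :: "(real^'d) set"
  assumes XY: "compact X" "compact Y"
    and feasible: "\<And>k. lp_feasible X Y \<mu> \<nu> (h k) (p k)"
    and sums: "\<And>k. (\<Sum>x\<in>grid_points (h k) X. grid_mass \<mu> (h k) x) = 1"
      "\<And>k. (\<Sum>y\<in>grid_points (h k) Y. grid_mass \<nu> (h k) y) = 1"
  obtains r :: "nat \<Rightarrow> nat" and \<pi> where "strict_mono r" and "prob_space \<pi>"
    and "sets \<pi> = sets (restrict_space borel (X \<times> Y))"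
    and "weakly_converges_on (X \<times> Y) (\<lambda>k. lp_measure X Y (h (r k)) (p (r k))) \<pi>"
    and "\<And>f. continuous_on (X \<times> Y) f \<Longrightarrow>
      (\<lambda>k. lp_cost X Y f (h (r k)) (p (r k))) \<longlonglongrightarrow> (\<integral>z. f z \<partial>\<pi>)"
proof -
  have Z: "compact (X \<times> Y)" using XY by (rule compact_Times)
  let ?G = "\<lambda>k. grid_points (h k) X \<times> grid_points (h k) Y"
  \<comment> \<open>A sum over an infinite set is zero by convention, so the value one forces the
    grids to be finite.\<close>
  have fin: "finite (grid_points (h k) X)" "finite (grid_points (h k) Y)" for k
    by (rule ccontr, use sums[of k] in simp)+
  have G: "?G k \<subseteq> X \<times> Y" for k by (auto simp: grid_points_def)
  have p: "0 \<le> p k x y" if "x \<in> grid_points (h k) X" "y \<in> grid_points (h k) Y" for k x y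
    using feasible[of k] that by (simp add: lp_feasible_def)
  have sets: "sets (lp_measure X Y (h k) (p k)) = sets (restrict_space borel (X \<times> Y))" for k
    by (simp add: lp_measure_def)
  have prob: "prob_space (lp_measure X Y (h k) (p k))" for k
  proof
    have top: "X \<times> Y \<in> sets (restrict_space borel (X \<times> Y))"
      using sets.top[of "restrict_space borel (X \<times> Y)"] by (simp add: space_restrict_space)
    have "space (lp_measure X Y (h k) (p k)) = X \<times> Y"
      by (simp add: lp_measure_def space_restrict_space)
    then have "emeasure (lp_measure X Y (h k) (p k)) (space (lp_measure X Y (h k) (p k))) =
        (\<Sum>x\<in>grid_points (h k) X. \<Sum>y\<in>grid_points (h k) Y. ennreal (p k x y) * indicator (X \<times> Y) (x, y))"
      using emeasure_lp_measure[OF fin top] by simp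
    also have "\<dots> = (\<Sum>x\<in>grid_points (h k) X. \<Sum>y\<in>grid_points (h k) Y. ennreal (p k x y))"
      using G[of k] by (intro sum.cong refl) (auto simp: indicator_def)
    also have "\<dots> = ennreal (\<Sum>x\<in>grid_points (h k) X. \<Sum>y\<in>grid_points (h k) Y. p k x y)"
      using p by (simp add: sum_nonneg cong: sum.cong)
    also have "(\<Sum>x\<in>grid_points (h k) X. \<Sum>y\<in>grid_points (h k) Y. p k x y) = 1"
      using feasible[of k] sums(1) by (simp add: lp_feasible_def)
    finally show "emeasure (lp_measure X Y (h k) (p k)) (space (lp_measure X Y (h k) (p k))) = 1" by simp
  qed
  have integral: "(\<integral>z. f z \<partial>lp_measure X Y (h k) (p k)) = lp_cost X Y f (h k) (p k)"
    if f: "continuous_on (X \<times> Y) f" for f k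
  proof -
    let ?P = "point_measure (?G k) (\<lambda>z. ennreal (case z of (x, y) \<Rightarrow> p k x y))"
    have P: "point_measure (?G k) (\<lambda>(x, y). ennreal (p k x y)) = ?P"
      by (simp add: case_prod_unfold)
    have "(\<lambda>z. z) \<in> measurable ?P (restrict_space borel (X \<times> Y))"
      using G[of k] by (auto simp: space_restrict_space)
    then have "(\<integral>z. f z \<partial>lp_measure X Y (h k) (p k)) = (\<integral>z. f z \<partial>?P)"
      unfolding lp_measure_def P using borel_measurable_continuous_on_restrict[OF f] by (rule integral_distr)
    also have "\<dots> = (\<Sum>z\<in>?G k. (case z of (x, y) \<Rightarrow> p k x y) *\<^sub>R f z)"
      using fin p by (intro lebesgue_integral_point_measure_finite) auto
    also have "\<dots> = lp_cost X Y f (h k) (p k)"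
      by (simp add: lp_cost_def sum.cartesian_product case_prod_unfold mult.commute)
    finally show ?thesis .
  qed
  obtain r \<pi> where r: "strict_mono r" and \<pi>: "prob_space \<pi>"
      "sets \<pi> = sets (restrict_space borel (X \<times> Y))"
    and conv: "weakly_converges_on (X \<times> Y) (\<lambda>k. lp_measure X Y (h (r k)) (p (r k))) \<pi>"
    using compact_weak_subsequence[OF Z, of "\<lambda>k. lp_measure X Y (h k) (p k)", OF prob sets] by blast
  have "(\<lambda>k. lp_cost X Y f (h (r k)) (p (r k))) \<longlonglongrightarrow> (\<integral>z. f z \<partial>\<pi>)"
    if f: "continuous_on (X \<times> Y) f" for f
  proof -
    have "bounded (f ` (X \<times> Y))"
      by (rule compact_imp_bounded[OF compact_continuous_image[OF f Z]])
    with conv f have "(\<lambda>k. \<integral>z. f z \<partial>lp_measure X Y (h (r k)) (p (r k))) \<longlonglongrightarrow> (\<integral>z. f z \<partial>\<pi>)"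
      unfolding weakly_converges_on_def by blast
    then show ?thesis
      by (simp only: integral[OF f])
  qed
  with r \<pi> conv show thesis by (rule that)
qed

text \<open>This provides a plan with known marginals to compare with. Restricting the product to
  \<open>X \<times> Y\<close> loses no mass, as \<open>X\<close> and \<open>Y\<close> have full
  measure.\<close>

lemma product_transference_plan:
  fixes X Y :: "(real^'d) set"
  assumes M: "prob_space \<mu>" "sets \<mu> = sets borel" "compact X" "AE x in \<mu>. x \<in> X"
    and N: "prob_space \<nu>" "sets \<nu> = sets borel" "compact Y" "AE y in \<nu>. y \<in> Y"
  shows "restrict_space (\<mu> \<Otimes>\<^sub>M \<nu>) (X \<times> Y) \<in> transference_plans X Y \<mu> \<nu>"
proof -
  interpret M: prob_space \<mu> by fact
  interpret N: prob_space \<nu> by fact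
  have XY: "X \<in> sets \<mu>" "Y \<in> sets \<nu>"
    using M(2,3) N(2,3) by (simp_all add: borel_compact)
  have one: "emeasure \<mu> X = 1" "emeasure \<nu> Y = 1"
    using M.emeasure_eq_1_AE[OF XY(1) M(4)] N.emeasure_eq_1_AE[OF XY(2) N(4)] by simp_all
  have sets: "sets (\<mu> \<Otimes>\<^sub>M \<nu>) = sets borel"
    using sets_pair_measure_cong[OF M(2) N(2)] by (simp only: borel_prod)
  have em: "emeasure (restrict_space (\<mu> \<Otimes>\<^sub>M \<nu>) (X \<times> Y)) (A \<times> B) = emeasure \<mu> A * emeasure \<nu> B"
    if "A \<in> sets \<mu>" "A \<subseteq> X" "B \<in> sets \<nu>" "B \<subseteq> Y" for A B
  proof -
    have "emeasure (restrict_space (\<mu> \<Otimes>\<^sub>M \<nu>) (X \<times> Y)) (A \<times> B) = emeasure (\<mu> \<Otimes>\<^sub>M \<nu>) (A \<times> B)"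
      using XY that by (intro emeasure_restrict_space sets.Int pair_measureI Sigma_mono sets.top)
    then show ?thesis
      using N.emeasure_pair_measure_Times[OF that(1,3)] by simp
  qed
  have "prob_space (restrict_space (\<mu> \<Otimes>\<^sub>M \<nu>) (X \<times> Y))"
  proof
    have "space (restrict_space (\<mu> \<Otimes>\<^sub>M \<nu>) (X \<times> Y)) = X \<times> Y"
      using sets_eq_imp_space_eq[OF sets] by (simp add: space_restrict_space)
    then show "emeasure (restrict_space (\<mu> \<Otimes>\<^sub>M \<nu>) (X \<times> Y)) (space (restrict_space (\<mu> \<Otimes>\<^sub>M \<nu>) (X \<times> Y))) = 1"
      using em[OF XY(1) _ XY(2)] one by simp
  qed
  then show ?thesis
    unfolding transference_plans_def using em XY one sets_restrict_space_cong[OF sets] M(2) N(2)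
    by (simp add: measure_def)
qed

text \<open>The entry at \<open>(x, y)\<close> is the mass that \<open>\<sigma>\<close> gives to the
  pairs rounded to \<open>(x, y)\<close>. Summing out one coordinate leaves a marginal of
  \<open>\<sigma>\<close> on a cube, which is the grid mass, and
  \<open>discretised_integral_tendsto\<close> handles the cost.\<close>

lemma grid_discretisation:
  fixes \<mu> \<nu> :: "(real^'d) measure" and X Y :: "(real^'d) set"
  assumes M: "prob_space \<mu>" "sets \<mu> = sets borel" "compact X" "AE x in \<mu>. x \<in> X"
    and N: "prob_space \<nu>" "sets \<nu> = sets borel" "compact Y" "AE y in \<nu>. y \<in> Y"
    and h: "\<And>k. 0 < h k" "h \<longlonglongrightarrow> 0"
    and sums: "\<And>k. (\<Sum>x\<in>grid_points (h k) X. grid_mass \<mu> (h k) x) = 1"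
      "\<And>k. (\<Sum>y\<in>grid_points (h k) Y. grid_mass \<nu> (h k) y) = 1"
  obtains q :: "((real^'d) \<times> (real^'d)) measure \<Rightarrow> nat \<Rightarrow> real^'d \<Rightarrow> real^'d \<Rightarrow> real"
  where "\<And>\<sigma> k. \<sigma> \<in> transference_plans X Y \<mu> \<nu> \<Longrightarrow> lp_feasible X Y \<mu> \<nu> (h k) (q \<sigma> k)"
    and "\<And>\<sigma> f. \<sigma> \<in> transference_plans X Y \<mu> \<nu> \<Longrightarrow> continuous_on (X \<times> Y) f \<Longrightarrow>
      (\<lambda>k. lp_cost X Y f (h k) (q \<sigma> k)) \<longlonglongrightarrow> (\<integral>z. f z \<partial>\<sigma>)"
proof -
  obtain T :: "real \<Rightarrow> real^'d \<Rightarrow> real^'d"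
    where T: "\<And>h. T h \<in> borel_measurable borel"
      and T_cube: "\<And>h z S. 0 < h \<Longrightarrow> z \<in> grid_points h S \<Longrightarrow> grid_cube h z = T h -` {z}"
      and T_dist: "\<And>h x. 0 < h \<Longrightarrow> dist (T h x) x \<le> real CARD('d) * h"
    using grid_rounding by blast
  have T_lim: "(\<lambda>k. T (h k) x) \<longlonglongrightarrow> x" for x
  proof (rule tendsto_dist_iff[THEN iffD2], rule tendsto_sandwich[OF _ _ tendsto_const])
    show "(\<lambda>k. real CARD('d) * h k) \<longlonglongrightarrow> 0"
      by (rule tendsto_mult_right_zero[OF h(2)])
    show "\<forall>\<^sub>F k in sequentially. dist (T (h k) x) x \<le> real CARD('d) * h k"
      using T_dist[OF h(1)] by (intro always_eventually allI)
  qed simp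
  have fin: "finite (grid_points (h k) X)" "finite (grid_points (h k) Y)" for k
    by (rule ccontr, use sums[of k] in simp)+
  let ?T2 = "\<lambda>k z. (T (h k) (fst z), T (h k) (snd z))"
  let ?G = "\<lambda>k. grid_points (h k) X \<times> grid_points (h k) Y"
  define q where "q \<sigma> k x y = measure \<sigma> (?T2 k -` {(x, y)} \<inter> space \<sigma>)" for \<sigma> k x y
  have "lp_feasible X Y \<mu> \<nu> (h k) (q \<sigma> k) \<and> (\<forall>f. continuous_on (X \<times> Y) f \<longrightarrow>
      (\<lambda>k. lp_cost X Y f (h k) (q \<sigma> k)) \<longlonglongrightarrow> (\<integral>z. f z \<partial>\<sigma>))"
    if plan: "\<sigma> \<in> transference_plans X Y \<mu> \<nu>" for \<sigma> k
  proof -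
    interpret prob_space \<sigma>
      using plan unfolding transference_plans_def by blast
    have sets: "sets \<sigma> = sets (restrict_space borel (X \<times> Y))"
      using plan unfolding transference_plans_def by blast
    have space: "space \<sigma> = X \<times> Y"
      using sets_eq_imp_space_eq[OF sets] by (simp add: space_restrict_space)
    have measurable: "f \<in> borel_measurable \<sigma>" if "continuous_on (X \<times> Y) f"
      for f :: "_ \<Rightarrow> 'b::topological_space"
      unfolding measurable_cong_sets[OF sets refl]
      using that by (rule borel_measurable_continuous_on_restrict)
    have proj: "fst \<in> borel_measurable \<sigma>" "snd \<in> borel_measurable \<sigma>"
      by (intro measurable continuous_intros)+
    \<comment> \<open>The marginal condition concerns subsets of \<open>X\<close> only, but grid
      cubes may stick out of \<open>X\<close>. Full measure of \<open>X\<close> extends the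
      condition to all Borel sets.\<close>
    have marginal_fst: "prob (fst -` A \<inter> space \<sigma>) = measure \<mu> A" if A: "A \<in> sets borel" for A
    proof -
      have AX: "A \<inter> X \<in> sets borel" by (intro sets.Int A borel_compact M)
      have "fst -` A \<inter> space \<sigma> = (A \<inter> X) \<times> Y" by (auto simp: space)
      then have "prob (fst -` A \<inter> space \<sigma>) = measure \<mu> (A \<inter> X)"
        using plan AX unfolding transference_plans_def by simp
      also have "\<dots> = measure \<mu> A"
      proof (rule measure_eq_AE)
        show "AE x in \<mu>. (x \<in> A \<inter> X) = (x \<in> A)"
          using M(4) by eventually_elim simp
      qed (simp_all only: M(2) A AX)
      finally show ?thesis .
    qed
    have marginal_snd: "prob (snd -` B \<inter> space \<sigma>) = measure \<nu> B" if B: "B \<in> sets borel" for B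
    proof -
      have BY: "B \<inter> Y \<in> sets borel" by (intro sets.Int B borel_compact N)
      have "snd -` B \<inter> space \<sigma> = X \<times> (B \<inter> Y)" by (auto simp: space)
      then have "prob (snd -` B \<inter> space \<sigma>) = measure \<nu> (B \<inter> Y)"
        using plan BY unfolding transference_plans_def by simp
      also have "\<dots> = measure \<nu> B"
      proof (rule measure_eq_AE)
        show "AE y in \<nu>. (y \<in> B \<inter> Y) = (y \<in> B)"
          using N(4) by eventually_elim simp
      qed (simp_all only: N(2) B BY)
      finally show ?thesis .
    qed
    have cell: "(\<lambda>z. T (h k) (w z)) -` {x} \<inter> space \<sigma> \<in> events" if "w \<in> borel_measurable \<sigma>" for w k x
      by (rule measurable_sets[OF measurable_compose[OF that T] borel_closed[OF closed_singleton]])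
    have cell_mass: "prob ((\<lambda>z. T (h k) (w z)) -` {x} \<inter> space \<sigma>) = grid_mass \<rho> (h k) x"
      if "\<And>A. A \<in> sets borel \<Longrightarrow> prob (w -` A \<inter> space \<sigma>) = measure \<rho> A" and x: "x \<in> grid_points (h k) S"
      for w \<rho> S k x
    proof -
      have "T (h k) -` {x} \<in> sets borel"
        using measurable_sets[OF T borel_closed[OF closed_singleton]] by simp
      from that(1)[OF this] show ?thesis
        by (simp add: grid_mass_def T_cube[OF h(1) x] vimage_def)
    qed
    \<comment> \<open>Rounding may carry a point of \<open>S\<close> out of \<open>S\<close>. The
      cells of the grid points in \<open>S\<close> are disjoint and their masses add up to one, so
      this happens on a null set only.\<close>
    have ae: "AE z in \<sigma>. T (h k) (w z) \<in> grid_points (h k) S"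
      if w: "w \<in> borel_measurable \<sigma>" "\<And>A. A \<in> sets borel \<Longrightarrow> prob (w -` A \<inter> space \<sigma>) = measure \<rho> A"
        and S: "(\<Sum>x\<in>grid_points (h k) S. grid_mass \<rho> (h k) x) = 1" for w \<rho> S k
    proof -
      let ?c = "\<lambda>x. (\<lambda>z. T (h k) (w z)) -` {x} \<inter> space \<sigma>"
      have fin: "finite (grid_points (h k) S)"
        by (rule ccontr) (use S in simp)
      have "prob (\<Union>x\<in>grid_points (h k) S. ?c x) = (\<Sum>x\<in>grid_points (h k) S. prob (?c x))"
        using cell[OF w(1)]
        by (intro finite_measure_finite_Union[OF fin]) (auto simp: disjoint_family_on_def)
      also have "\<dots> = (\<Sum>x\<in>grid_points (h k) S. grid_mass \<rho> (h k) x)"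
        by (rule sum.cong[OF refl cell_mass[OF w(2)]])
      finally have "prob (\<Union>x\<in>grid_points (h k) S. ?c x) = 1"
        using S by simp
      then have "AE z in \<sigma>. z \<in> (\<Union>x\<in>grid_points (h k) S. ?c x)"
        using prob_eq_1[OF sets.finite_UN[OF fin cell[OF w(1)]]] by simp
      then show ?thesis by (rule eventually_mono) auto
    qed
    \<comment> \<open>Total probability over the fibres of \<open>v\<close>, which cover almost
      everything. With \<open>A\<close> a cell of the other coordinate this yields the row and
      column sums.\<close>
    have fibres: "(\<Sum>y\<in>H. prob (A \<inter> (v -` {y} \<inter> space \<sigma>))) = prob A"
      if "finite H" and A: "A \<in> events" and v: "\<And>y. v -` {y} \<inter> space \<sigma> \<in> events"
        and v_ae: "AE z in \<sigma>. v z \<in> H" for A H and v :: "_ \<Rightarrow> real^'d"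
    proof -
      have cells: "A \<inter> (v -` {y} \<inter> space \<sigma>) \<in> events" for y
        by (rule sets.Int[OF A v])
      have "(\<Sum>y\<in>H. prob (A \<inter> (v -` {y} \<inter> space \<sigma>))) = prob (\<Union>y\<in>H. A \<inter> (v -` {y} \<inter> space \<sigma>))"
        using cells
        by (intro finite_measure_finite_Union[OF that(1), symmetric]) (auto simp: disjoint_family_on_def)
      also have "\<dots> = prob A"
      proof (rule finite_measure_eq_AE)
        show "AE z in \<sigma>. (z \<in> (\<Union>y\<in>H. A \<inter> (v -` {y} \<inter> space \<sigma>))) = (z \<in> A)"
          using v_ae AE_space by eventually_elim simp
      qed (rule sets.finite_UN[OF that(1) cells] A)+
      finally show ?thesis .
    qed
    have ae_fst: "AE z in \<sigma>. T (h k) (fst z) \<in> grid_points (h k) X" for k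
      by (rule ae[OF proj(1) marginal_fst sums(1)])
    have ae_snd: "AE z in \<sigma>. T (h k) (snd z) \<in> grid_points (h k) Y" for k
      by (rule ae[OF proj(2) marginal_snd sums(2)])
    have T2: "?T2 k -` {(x, y)} \<inter> space \<sigma> = ((\<lambda>z. T (h k) (fst z)) -` {x} \<inter> space \<sigma>) \<inter>
        ((\<lambda>z. T (h k) (snd z)) -` {y} \<inter> space \<sigma>)" for k x y
      by blast
    have row: "(\<Sum>y\<in>grid_points (h k) Y. q \<sigma> k x y) = grid_mass \<mu> (h k) x" if "x \<in> grid_points (h k) X" for x
      unfolding q_def T2 fibres[OF fin(2) cell[OF proj(1)] cell[OF proj(2)] ae_snd]
      by (rule cell_mass[OF marginal_fst that])
    have col: "(\<Sum>x\<in>grid_points (h k) X. q \<sigma> k x y) = grid_mass \<nu> (h k) y" if "y \<in> grid_points (h k) Y" for y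
      unfolding q_def T2 Int_commute[of "(\<lambda>z. T (h k) (fst z)) -` {_} \<inter> space \<sigma>"]
        fibres[OF fin(1) cell[OF proj(2)] cell[OF proj(1)] ae_fst]
      by (rule cell_mass[OF marginal_snd that])
    have feasible: "lp_feasible X Y \<mu> \<nu> (h k) (q \<sigma> k)"
      unfolding lp_feasible_def
      by (intro conjI ballI row col) (simp_all only: q_def measure_nonneg)
    have "(\<lambda>k. lp_cost X Y f (h k) (q \<sigma> k)) \<longlonglongrightarrow> (\<integral>z. f z \<partial>\<sigma>)" if f: "continuous_on (X \<times> Y) f" for f
    proof -
      have "(\<lambda>k. \<Sum>z\<in>?G k. f z * prob (?T2 k -` {z} \<inter> space \<sigma>)) \<longlonglongrightarrow> (\<integral>z. f z \<partial>\<sigma>)"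
      proof (rule discretised_integral_tendsto[OF _ compact_Times[OF M(3) N(3)] f measurable[OF f]])
        show "prob_space \<sigma>" by (rule prob_space_axioms)
        show "AE z in \<sigma>. z \<in> X \<times> Y"
          using AE_space[of \<sigma>] by (simp only: space)
        show "AE z in \<sigma>. ?T2 k z \<in> ?G k" for k
          using ae_fst ae_snd by eventually_elim simp
        show "?T2 k -` {z} \<inter> space \<sigma> \<in> events" for k z
          using sets.Int[OF cell[OF proj(1)] cell[OF proj(2)], of k "fst z" k "snd z"]
          by (simp only: T2[symmetric] prod.collapse)
        show "(\<lambda>k. ?T2 k z) \<longlonglongrightarrow> z" for z
          using tendsto_Pair[OF T_lim[of "fst z"] T_lim[of "snd z"]] by (simp only: prod.collapse)
        show "finite (?G k)" for k
          by (intro finite_cartesian_product fin)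
        show "?G k \<subseteq> X \<times> Y" for k
          by (auto simp: grid_points_def)
      qed
      moreover have "(\<Sum>z\<in>?G k. f z * prob (?T2 k -` {z} \<inter> space \<sigma>)) = lp_cost X Y f (h k) (q \<sigma> k)" for k
        unfolding lp_cost_def q_def sum.cartesian_product by (simp only: case_prod_unfold prod.collapse)
      ultimately show ?thesis by (simp only:)
    qed
    with feasible show ?thesis by blast
  qed
  then show thesis using that by blast
qed

section \<open>Convergence of optimal plans\<close>

theorem theorem4:
  fixes \<mu> \<nu> :: "(real^'d) measure"
    and X Y :: "(real^'d) set"
    and c :: "(real^'d) \<times> (real^'d) \<Rightarrow> real"
    and h :: "nat \<Rightarrow> real"
    and p :: "nat \<Rightarrow> real^'d \<Rightarrow> real^'d \<Rightarrow> real"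
  assumes "prob_space \<mu>" and "sets \<mu> = sets borel"
    and "prob_space \<nu>" and "sets \<nu> = sets borel"
    and "X = measure_support \<mu>" and "compact X"
    and "Y = measure_support \<nu>" and "compact Y"
    and "continuous_on (X \<times> Y) c"
    and "\<And>k. 0 < h k" and "h \<longlonglongrightarrow> 0"
    and "\<And>k. (\<Sum>x\<in>grid_points (h k) X. grid_mass \<mu> (h k) x) = 1"
    and "\<And>k. (\<Sum>y\<in>grid_points (h k) Y. grid_mass \<nu> (h k) y) = 1"
    and "\<And>k. lp_optimal X Y \<mu> \<nu> c (h k) (p k)"
  shows "\<exists>r \<pi>. strict_mono (r::nat \<Rightarrow> nat) \<and> optimal_plan X Y \<mu> \<nu> c \<pi> \<and>
    weakly_converges_on (X \<times> Y) (\<lambda>k. lp_measure X Y (h (r k)) (p (r k))) \<pi>"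
proof -
  note sums = assms(12,13)
  have ae: "AE x in \<mu>. x \<in> X" "AE y in \<nu>. y \<in> Y"
    unfolding assms(5,7) by (rule AE_measure_support[OF assms(2)], rule AE_measure_support[OF assms(4)])
  note M = assms(1,2,6) ae(1) and N = assms(3,4,8) ae(2)
  have opt: "is_arg_min (lp_cost X Y c (h k)) (lp_feasible X Y \<mu> \<nu> (h k)) (p k)" for k
    using assms(14)[of k] unfolding lp_optimal_def .
  then have feasible: "lp_feasible X Y \<mu> \<nu> (h k) (p k)" for k
    unfolding is_arg_min_def by (rule conjunct1)
  obtain r \<pi> where r: "strict_mono r" and \<pi>: "prob_space \<pi>"
      "sets \<pi> = sets (restrict_space borel (X \<times> Y))"
    and conv: "weakly_converges_on (X \<times> Y) (\<lambda>k. lp_measure X Y (h (r k)) (p (r k))) \<pi>"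
    and lim: "\<And>f. continuous_on (X \<times> Y) f \<Longrightarrow>
      (\<lambda>k. lp_cost X Y f (h (r k)) (p (r k))) \<longlonglongrightarrow> (\<integral>z. f z \<partial>\<pi>)"
    by (rule lp_weak_limit[where h = h and p = p, OF assms(6,8) feasible sums], rule that; simp)
  obtain q where q: "\<And>\<sigma> k. \<sigma> \<in> transference_plans X Y \<mu> \<nu> \<Longrightarrow> lp_feasible X Y \<mu> \<nu> (h k) (q \<sigma> k)"
    and q_lim: "\<And>\<sigma> f. \<sigma> \<in> transference_plans X Y \<mu> \<nu> \<Longrightarrow> continuous_on (X \<times> Y) f \<Longrightarrow>
      (\<lambda>k. lp_cost X Y f (h k) (q \<sigma> k)) \<longlonglongrightarrow> (\<integral>z. f z \<partial>\<sigma>)"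
    by (rule grid_discretisation[where h = h, OF M N assms(10,11) sums], rule that; simp)
  \<comment> \<open>The reference plan against which the marginals of \<open>\<pi>\<close> are
    identified.\<close>
  obtain \<sigma>\<^sub>0 where \<sigma>\<^sub>0: "\<sigma>\<^sub>0 \<in> transference_plans X Y \<mu> \<nu>"
    using product_transference_plan[OF M N] by blast
  then have plan\<^sub>0: "prob_space \<sigma>\<^sub>0" "sets \<sigma>\<^sub>0 = sets (restrict_space borel (X \<times> Y))"
    unfolding transference_plans_def by blast+
  have q_lim_r: "(\<lambda>k. lp_cost X Y f (h (r k)) (q \<sigma> (r k))) \<longlonglongrightarrow> (\<integral>z. f z \<partial>\<sigma>)"
    if "\<sigma> \<in> transference_plans X Y \<mu> \<nu>" "continuous_on (X \<times> Y) f" for \<sigma> f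
    using LIMSEQ_subseq_LIMSEQ[OF q_lim[OF that] r] by (simp only: comp_def)
  \<comment> \<open>The hypothesis \<open>cost\<close> says that the discrete cost of
    \<open>f\<close> composed with \<open>w\<close> takes one value \<open>C f h\<close> on all
    feasible matrices. Hence \<open>p\<close> and the discretised \<open>\<sigma>\<^sub>0\<close>
    yield the same sequence of costs, and its limit is both integrals.\<close>
  have marginal: "distr \<pi> borel w = distr \<sigma>\<^sub>0 borel w"
    if w: "continuous_on (X \<times> Y) w"
      and cost: "\<And>f p h. lp_feasible X Y \<mu> \<nu> h p \<Longrightarrow> lp_cost X Y (\<lambda>z. f (w z)) h p = C f h"
    for w :: "(real^'d) \<times> (real^'d) \<Rightarrow> real^'d" and C
  proof (rule borel_prob_eqI)
    have meas: "w \<in> borel_measurable \<pi>" "w \<in> borel_measurable \<sigma>\<^sub>0"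
      unfolding measurable_cong_sets[OF \<pi>(2) refl] measurable_cong_sets[OF plan\<^sub>0(2) refl]
      using w by (rule borel_measurable_continuous_on_restrict)+
    then show "prob_space (distr \<pi> borel w)" "prob_space (distr \<sigma>\<^sub>0 borel w)"
      using \<pi>(1) plan\<^sub>0(1) by (simp_all only: prob_space.prob_space_distr)
    fix f :: "real^'d \<Rightarrow> real" assume f: "continuous_on UNIV f"
    have fw: "continuous_on (X \<times> Y) (\<lambda>z. f (w z))"
      using w by (rule continuous_on_compose2[OF f]) simp
    have "(\<integral>z. f (w z) \<partial>\<pi>) = (\<integral>z. f (w z) \<partial>\<sigma>\<^sub>0)"
      using lim[OF fw] q_lim_r[OF \<sigma>\<^sub>0 fw] unfolding cost[OF feasible] cost[OF q[OF \<sigma>\<^sub>0]]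
      by (rule LIMSEQ_unique)
    then show "(\<integral>x. f x \<partial>distr \<pi> borel w) = (\<integral>x. f x \<partial>distr \<sigma>\<^sub>0 borel w)"
      using meas borel_measurable_continuous_onI[OF f] by (simp only: integral_distr)
  qed (rule sets_distr)+
  have cost_fst: "lp_cost X Y (\<lambda>z. f (fst z)) h p = (\<Sum>x\<in>grid_points h X. f x * grid_mass \<mu> h x)"
    if "lp_feasible X Y \<mu> \<nu> h p" for f p h
    using that by (simp add: lp_cost_def lp_feasible_def flip: sum_distrib_left)
  \<comment> \<open>The column constraint sums over \<open>x\<close>, so the order of summation is
    exchanged first.\<close>
  have cost_snd: "lp_cost X Y (\<lambda>z. f (snd z)) h p = (\<Sum>y\<in>grid_points h Y. f y * grid_mass \<nu> h y)"
    if "lp_feasible X Y \<mu> \<nu> h p" for f p h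
    unfolding lp_cost_def using that
    by (subst sum.swap) (simp add: lp_feasible_def flip: sum_distrib_left)
  have same: "measure \<pi> (w -` A \<inter> (X \<times> Y)) = measure \<sigma>\<^sub>0 (w -` A \<inter> (X \<times> Y))"
    if "distr \<pi> borel w = distr \<sigma>\<^sub>0 borel w" and w: "continuous_on (X \<times> Y) w" and A: "A \<in> sets borel"
    for w :: "(real^'d) \<times> (real^'d) \<Rightarrow> real^'d" and A
  proof -
    have "w \<in> borel_measurable \<pi>" "w \<in> borel_measurable \<sigma>\<^sub>0"
      unfolding measurable_cong_sets[OF \<pi>(2) refl] measurable_cong_sets[OF plan\<^sub>0(2) refl]
      using w by (rule borel_measurable_continuous_on_restrict)+
    from measure_distr[OF this(1) A] measure_distr[OF this(2) A] show ?thesis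
      using sets_eq_imp_space_eq[OF \<pi>(2)] sets_eq_imp_space_eq[OF plan\<^sub>0(2)] that(1)
      by (simp add: space_restrict_space)
  qed
  have proj: "continuous_on (X \<times> Y) fst" "continuous_on (X \<times> Y) snd"
    by (intro continuous_intros)+
  have plan: "\<pi> \<in> transference_plans X Y \<mu> \<nu>"
    unfolding transference_plans_def
  proof (intro CollectI conjI ballI impI \<pi>)
    fix A :: "(real^'d) set" assume A: "A \<in> sets borel"
    show "measure \<pi> (A \<times> Y) = measure \<mu> A" if "A \<subseteq> X"
    proof -
      have "fst -` A \<inter> (X \<times> Y) = A \<times> Y" using that by auto
      then have "measure \<pi> (A \<times> Y) = measure \<sigma>\<^sub>0 (A \<times> Y)"
        using same[OF marginal[OF proj(1) cost_fst] proj(1) A] by simp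
      also have "\<dots> = measure \<mu> A"
        using \<sigma>\<^sub>0 A that unfolding transference_plans_def by blast
      finally show ?thesis .
    qed
    show "measure \<pi> (X \<times> A) = measure \<nu> A" if "A \<subseteq> Y"
    proof -
      have "snd -` A \<inter> (X \<times> Y) = X \<times> A" using that by auto
      then have "measure \<pi> (X \<times> A) = measure \<sigma>\<^sub>0 (X \<times> A)"
        using same[OF marginal[OF proj(2) cost_snd] proj(2) A] by simp
      also have "\<dots> = measure \<nu> A"
        using \<sigma>\<^sub>0 A that unfolding transference_plans_def by blast
      finally show ?thesis .
    qed
  qed
  \<comment> \<open>At each resolution \<open>p\<close> is optimal and the discretised
    \<open>\<sigma>\<close> is feasible; both discrete costs converge along \<open>r\<close>, so the
    inequality survives in the limit.\<close>
  have "transport_cost c \<pi> \<le> transport_cost c \<sigma>" if \<sigma>: "\<sigma> \<in> transference_plans X Y \<mu> \<nu>" for \<sigma>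
    unfolding transport_cost_def
  proof (rule LIMSEQ_le[OF lim[OF assms(9)] q_lim_r[OF \<sigma> assms(9)]], intro exI allI impI)
    show "lp_cost X Y c (h (r k)) (p (r k)) \<le> lp_cost X Y c (h (r k)) (q \<sigma> (r k))" for k
      using opt[of "r k"] q[OF \<sigma>] unfolding is_arg_min_linorder by blast
  qed
  then have "optimal_plan X Y \<mu> \<nu> c \<pi>"
    using plan by (simp add: optimal_plan_def is_arg_min_linorder)
  then show ?thesis using r conv by blast
qed

end
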